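(* Let $C_t$, $t\in[0,1]$, be a continuous expansive motion of a polygonal chain whose bars in $C_0$ have pairwise disjoint relative interiors (bars meet only at shared hinge vertices). Suppose each bar carries a slender (not necessarily symmetric) adornment with that bar as base, and the adornments in $C_0$ pairwise do not overlap. Then for every $t\in[0,1]$ the adornments, carried along rigidly with their bars, pairwise do not overlap in $C_t$.
   Context: An adornment is a compact simply connected region $S\subset\mathbb{R}^2$ together with a segment $[x,y]$, $x\ne y$, with endpoints on the boundary of $S$ and $[x,y]\subseteq S$ (the base); its boundary consists of two arcs from $x$ to $y$ (the sides). It is slender if, for a point $p$ moving along either side from $x$ to $y$, $\|p-x\|$ is nondecreasing and $\|p-y\|$ is nonincreasing. A polygonal chain consists of vertices and bars joining consecutive vertices (open or closed); a configuration assigns vertex positions preserving bar lengths. An adornment attached to a bar moves with it by the orientation-preserving rigid motion taking the bar to its new position; points of the chain in different configurations correspond via these rigid motions. Configuration $Y$ is an expansion of $X$ if for any two points $p,q$ of the chain in $X$, the corresponding points $p',q'$ in $Y$ satisfy $\|p'-q'\|\ge\|p-q\|$. A continuous expansive motion is a continuous family of configurations $C_t$, $t\in[0,1]$, such that $C_{t'}$ is an expansion of $C_t$ whenever $t\le t'$. Two adornments overlap if some point of one lies in the interior of the other. *)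

theory Defs
  imports "HOL-Analysis.Analysis"
begin

text \<open>The plane is modelled by the type complex (identified with R^2).
  Orientation-preserving rigid motions are the maps z \<mapsto> a*z + b with norm a = 1.\<close>

definition chain_bars :: "nat \<Rightarrow> bool \<Rightarrow> (nat \<times> nat) set" where
  "chain_bars n closed_chain =
     {(i, Suc i) | i. Suc i < n} \<union> (if closed_chain then {(n - 1, 0)} else {})"

definition is_side :: "complex \<Rightarrow> complex \<Rightarrow> (real \<Rightarrow> complex) \<Rightarrow> bool" where
  "is_side x y g \<longleftrightarrow> arc g \<and> pathstart g = x \<and> pathfinish g = y"

definition adornment :: "complex set \<Rightarrow> complex \<Rightarrow> complex \<Rightarrow> bool" where
  "adornment S x y \<longleftrightarrow>
     compact S \<and> simply_connected S \<and> x \<noteq> y \<and> x \<in> frontier S \<and> y \<in> frontier S \<and>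
     closed_segment x y \<subseteq> S \<and>
     (\<exists>g1 g2. is_side x y g1 \<and> is_side x y g2 \<and>
        frontier S = path_image g1 \<union> path_image g2)"

definition slender_side :: "complex \<Rightarrow> complex \<Rightarrow> (real \<Rightarrow> complex) \<Rightarrow> bool" where
  "slender_side x y g \<longleftrightarrow>
     (\<forall>s\<in>{0..1}. \<forall>s'\<in>{0..1}. s \<le> s' \<longrightarrow>
        dist (g s) x \<le> dist (g s') x \<and> dist (g s') y \<le> dist (g s) y)"

definition slender_adornment :: "complex set \<Rightarrow> complex \<Rightarrow> complex \<Rightarrow> bool" where
  "slender_adornment S x y \<longleftrightarrow>
     adornment S x y \<and>
     (\<exists>g1 g2. is_side x y g1 \<and> is_side x y g2 \<and>
        frontier S = path_image g1 \<union> path_image g2 \<and>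
        slender_side x y g1 \<and> slender_side x y g2)"

text \<open>The orientation-preserving rigid motion taking segment (p0,q0) to (p,q)
  (for q0 \<noteq> p0 and dist p q = dist p0 q0).\<close>
definition rigid_to :: "complex \<Rightarrow> complex \<Rightarrow> complex \<Rightarrow> complex \<Rightarrow> complex \<Rightarrow> complex" where
  "rigid_to p0 q0 p q z = ((q - p) / (q0 - p0)) * (z - p0) + p"

definition bar_point :: "(nat \<Rightarrow> complex) \<Rightarrow> nat \<times> nat \<Rightarrow> real \<Rightarrow> complex" where
  "bar_point X b s = linepath (X (fst b)) (X (snd b)) s"

definition is_expansion ::
  "(nat \<times> nat) set \<Rightarrow> (nat \<Rightarrow> complex) \<Rightarrow> (nat \<Rightarrow> complex) \<Rightarrow> bool" where
  "is_expansion bars X Y \<longleftrightarrow>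
     (\<forall>b\<in>bars. \<forall>b'\<in>bars. \<forall>s\<in>{0..1}. \<forall>s'\<in>{0..1}.
        dist (bar_point X b s) (bar_point X b' s') \<le> dist (bar_point Y b s) (bar_point Y b' s'))"

definition continuous_expansive_motion ::
  "nat \<Rightarrow> (nat \<times> nat) set \<Rightarrow> (real \<Rightarrow> nat \<Rightarrow> complex) \<Rightarrow> bool" where
  "continuous_expansive_motion n bars C \<longleftrightarrow>
     (\<forall>v<n. continuous_on {0..1} (\<lambda>t. C t v)) \<and>
     (\<forall>t\<in>{0..1}. \<forall>(i,j)\<in>bars. dist (C t i) (C t j) = dist (C 0 i) (C 0 j)) \<and>
     (\<forall>t t'. 0 \<le> t \<and> t \<le> t' \<and> t' \<le> 1 \<longrightarrow> is_expansion bars (C t) (C t'))"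

definition overlap :: "complex set \<Rightarrow> complex set \<Rightarrow> bool" where
  "overlap S T \<longleftrightarrow> (S \<inter> interior T \<noteq> {} \<or> T \<inter> interior S \<noteq> {})"

definition placed_adornment ::
  "(real \<Rightarrow> nat \<Rightarrow> complex) \<Rightarrow> (nat \<times> nat \<Rightarrow> complex set) \<Rightarrow> real \<Rightarrow> nat \<times> nat \<Rightarrow> complex set" where
  "placed_adornment C A t b =
     rigid_to (C 0 (fst b)) (C 0 (snd b)) (C t (fst b)) (C t (snd b)) ` A b"

end

theory Submission
  imports Defs "HOL-Complex_Analysis.Cauchy_Integral_Formula"
begin

text \<open>A slender adornment contains, with every point \<open>p\<close> off its base, the half lens of all points
  on the same side of the base that are closer than \<open>p\<close> to both of its ends. So if two adornments
  overlap, then two half lenses meet, or a bar enters a half lens; it suffices to follow this back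
  in time to the initial configuration. A point of a bar in a half lens stays in the lens, because
  its distances to the two ends of the other bar only decrease in reversed time, and it cannot change
  sides without running through the other bar, which bars never do. The discs that bound two
  lenses keep a common point in reversed time by Kirszbraun's theorem, and this common region cannot
  change sides either, as otherwise a bar would enter a half lens.\<close>

section \<open>Kirszbraun's theorem for finitely many points\<close>

text \<open>Reversed time turns an expansion into a contraction of the four ends of two bars, which
  is what Kirszbraun's theorem asks for. But that theorem sees distances only: it ignores the side
  of a base, and it gives no continuous dependence on time. As adornments need not be symmetric, a
  common point of two full lenses proves nothing yet. Hence the proof follows a whole region, the
  convex intersection of four open discs, instead of a single point. What ties sides to bars is a
  bound on the radii: no point of a slender adornment is farther from an end of the base than the
  base is long. A lens with such radii meets the line of its base only in the base itself, so every
  change of side inside the lens is a contact with the bar.\<close>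

lemma kirszbraun_finite:
  fixes x x' :: "'i \<Rightarrow> 'a::euclidean_space"
  assumes fin: "finite I"
    and contr: "\<And>i j. i \<in> I \<Longrightarrow> j \<in> I \<Longrightarrow> dist (x' i) (x' j) \<le> dist (x i) (x j)"
  obtains q where "\<And>i. i \<in> I \<Longrightarrow> dist q (x' i) \<le> dist p (x i)"
proof (cases "I = {}")
  case True
  then show ?thesis using that by auto
next
  case False
  text \<open>Minimize the largest excess \<open>m = max h i q\<close> over \<open>q\<close>. The minimizer lies in the convex hull of
    the centres at which the maximum is attained; writing it as a convex combination of them
    contradicts contraction unless \<open>m \<le> 0\<close>.\<close>
  define h where "h i q = (norm (q - x' i))\<^sup>2 - (norm (p - x i))\<^sup>2" for i q
  obtain i0 where i0: "i0 \<in> I" using False by auto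
  define M where "M = Max ((\<lambda>i. \<bar>h i 0\<bar>) ` I)"
  have M: "\<bar>h i 0\<bar> \<le> M" if "i \<in> I" for i
    unfolding M_def using fin that by simp
  have M0: "0 \<le> M" using M[OF i0] by linarith
  \<comment> \<open>The region above the graph of the largest excess, cut to heights between 0 and
    \<open>M\<close>. The cut makes it bounded, and \<open>M\<close> dominates all excesses at the
    origin, so \<open>(0, M)\<close> lies in it.\<close>
  define K where "K = {z::'a \<times> real. 0 \<le> snd z \<and> snd z \<le> M \<and> (\<forall>i\<in>I. h i (fst z) \<le> snd z)}"
  have "closed K"
  proof -
    have "K = {z. 0 \<le> snd z} \<inter> {z. snd z \<le> M} \<inter> (\<Inter>i\<in>I. {z. h i (fst z) \<le> snd z})"
      unfolding K_def by auto
    moreover have "closed \<dots>"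
      unfolding h_def
      by (intro closed_Int closed_INT ballI closed_Collect_le continuous_intros)
    ultimately show ?thesis by simp
  qed
  moreover have "bounded K"
  proof -
    define R where "R = sqrt (M + (norm (p - x i0))\<^sup>2)"
    have "K \<subseteq> cball (x' i0) R \<times> {0..M}"
    proof
      fix z assume z: "z \<in> K"
      have "h i0 (fst z) \<le> M" using z i0 unfolding K_def by force
      then have "norm (fst z - x' i0) \<le> R"
        unfolding R_def h_def by (intro real_le_rsqrt) auto
      then show "z \<in> cball (x' i0) R \<times> {0..M}"
        using z unfolding K_def by (cases z) (auto simp: dist_norm norm_minus_commute)
    qed
    then show ?thesis
      by (rule bounded_subset[rotated]) (auto intro!: bounded_Times)
  qed
  ultimately have "compact K" by (simp add: compact_eq_bounded_closed)
  moreover have "(0, M) \<in> K" unfolding K_def using M M0 by (auto simp: abs_le_iff)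
  ultimately obtain z where z: "z \<in> K" and zmin: "\<And>w. w \<in> K \<Longrightarrow> snd z \<le> snd w"
    using continuous_attains_inf[of K snd] continuous_on_snd continuous_on_id by blast
  obtain q m where zq: "z = (q, m)" by (cases z)
  have m: "0 \<le> m" "m \<le> M" "\<And>i. i \<in> I \<Longrightarrow> h i q \<le> m"
    using z unfolding K_def zq by auto
  have "m \<le> 0"
  proof (rule ccontr)
    assume "\<not> m \<le> 0"
    then have mpos: "0 < m" by simp
    define A where "A = {i \<in> I. h i q = m}"
    have A: "A \<subseteq> I" "finite A" using fin unfolding A_def by auto
    have "q \<in> convex hull (x' ` A)"
    proof (rule ccontr)
      assume "q \<notin> convex hull (x' ` A)"
      moreover have "closed (convex hull (x' ` A))"
        using A by (intro compact_imp_closed compact_convex_hull finite_imp_compact) auto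
      ultimately obtain a b where ab: "a \<bullet> q < b" "\<And>w. w \<in> convex hull (x' ` A) \<Longrightarrow> a \<bullet> w > b"
        using separating_hyperplane_closed_point[OF convex_convex_hull, of "x' ` A" q] by blast
      \<comment> \<open>The normal \<open>a\<close> points from \<open>q\<close> towards all active
        centres: a small step along it lowers every active excess, and the inactive ones stay below
        \<open>m\<close> by continuity. This beats the minimum.\<close>
      have ev: "\<forall>\<^sub>F e in at_right (0::real). h i (q + e *\<^sub>R a) < m" if i: "i \<in> I" for i
      proof (cases "i \<in> A")
        case True
        have neg: "a \<bullet> (q - x' i) < 0"
          using ab(1) ab(2)[of "x' i"] True hull_subset[of "x' ` A" convex]
          by (auto simp: inner_diff_right)
        have "((\<lambda>e. 2 * (a \<bullet> (q - x' i)) + e * (a \<bullet> a)) \<longlongrightarrow> 2 * (a \<bullet> (q - x' i)) + 0 * (a \<bullet> a)) (at_right (0::real))"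
          by (intro tendsto_intros)
        then have "\<forall>\<^sub>F e in at_right (0::real). 2 * (a \<bullet> (q - x' i)) + e * (a \<bullet> a) < 0"
          by (rule order_tendstoD(2)) (use neg in simp)
        then show ?thesis
          using eventually_at_right_less[of "0::real"]
        proof eventually_elim
          case (elim e)
          have "h i (q + e *\<^sub>R a) = h i q + e * (2 * (a \<bullet> (q - x' i)) + e * (a \<bullet> a))"
            unfolding h_def power2_norm_eq_inner
            by (simp add: inner_simps inner_commute algebra_simps)
          moreover have "e * (2 * (a \<bullet> (q - x' i)) + e * (a \<bullet> a)) < 0"
            using elim by (simp add: mult_pos_neg)
          ultimately show ?case using True unfolding A_def by simp
        qed
      next
        case False
        then have "h i (q + 0 *\<^sub>R a) < m" using m(3)[OF i] i unfolding A_def by force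
        moreover have "((\<lambda>e. h i (q + e *\<^sub>R a)) \<longlongrightarrow> h i (q + 0 *\<^sub>R a)) (at_right (0::real))"
          unfolding h_def by (intro tendsto_intros)
        ultimately show ?thesis by (rule order_tendstoD(2)[rotated])
      qed
      have "\<forall>\<^sub>F e in at_right (0::real). \<forall>i\<in>I. h i (q + e *\<^sub>R a) < m"
        using fin ev by (simp add: eventually_ball_finite)
      from eventually_happens'[OF trivial_limit_at_right_real this] obtain e where e: "\<And>i. i \<in> I \<Longrightarrow> h i (q + e *\<^sub>R a) < m"
        by blast
      have "\<forall>\<^sub>F m' in at_left m. \<forall>i\<in>I. h i (q + e *\<^sub>R a) < m'"
        by (intro eventually_ball_finite fin ballI eventually_at_leftI[OF _ e]) auto
      moreover have "\<forall>\<^sub>F m' in at_left m. 0 < m'"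
        using mpos by (intro eventually_at_leftI[of 0]) auto
      moreover have "\<forall>\<^sub>F m' in at_left m. m' < m"
        using mpos by (intro eventually_at_leftI[of 0]) auto
      ultimately have "\<forall>\<^sub>F m' in at_left m. (\<forall>i\<in>I. h i (q + e *\<^sub>R a) < m') \<and> 0 < m' \<and> m' < m"
        by eventually_elim auto
      from eventually_happens'[OF trivial_limit_at_left_real this] obtain m' where "\<forall>i\<in>I. h i (q + e *\<^sub>R a) < m'" "0 < m'" "m' < m"
        by blast
      then have "(q + e *\<^sub>R a, m') \<in> K" using m(2) unfolding K_def by fastforce
      from zmin[OF this] show False using \<open>m' < m\<close> by (simp add: zq)
    qed
    then obtain c where c: "\<And>y. y \<in> x' ` A \<Longrightarrow> 0 \<le> c y" "sum c (x' ` A) = 1"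
        "(\<Sum>y\<in>x' ` A. c y *\<^sub>R y) = q"
      using A by (auto simp: convex_hull_finite)
    define B where "B = x' ` A"
    \<comment> \<open>\<open>x'\<close> need not be injective, so the combination runs over centres,
      and \<open>j\<close> chooses one active index for each.\<close>
    define j where "j = inv_into A x'"
    have j: "j y \<in> A" "x' (j y) = y" if "y \<in> B" for y
      using that unfolding B_def j_def by (auto intro: inv_into_into f_inv_into_f)
    define u where "u y = y - q" for y
    define v where "v y = x (j y) - p" for y
    have nu: "u y \<bullet> u y = v y \<bullet> v y + m" if "y \<in> B" for y
      using j[OF that] unfolding A_def h_def u_def v_def
      by (simp add: power2_norm_eq_inner inner_diff_left inner_diff_right inner_commute)
    \<comment> \<open>Expand the contraction of squared distances and cancel the diagonal terms by
      \<open>nu\<close>. Summed with weights \<open>c y * c w\<close>, this makes the square of the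
      zero vector at least \<open>m\<close>.\<close>
    have uv: "v y \<bullet> v w + m \<le> u y \<bullet> u w" if "y \<in> B" "w \<in> B" for y w
    proof -
      have "norm (u y - u w) \<le> norm (v y - v w)"
        using contr[of "j y" "j w"] j[OF that(1)] j[OF that(2)] A(1)
        unfolding u_def v_def by (auto simp: dist_norm)
      then have "(u y - u w) \<bullet> (u y - u w) \<le> (v y - v w) \<bullet> (v y - v w)"
        by (simp add: norm_le)
      then show ?thesis
        using nu[OF that(1)] nu[OF that(2)] by (simp add: inner_diff_left inner_diff_right inner_commute)
    qed
    have s1: "sum c B = 1" using c(2) B_def by simp
    have sq: "(\<Sum>y\<in>B. c y *\<^sub>R f y) \<bullet> (\<Sum>y\<in>B. c y *\<^sub>R f y)
        = (\<Sum>y\<in>B. \<Sum>w\<in>B. c y * c w * (f y \<bullet> f w))" for f :: "'a \<Rightarrow> 'a"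
      unfolding inner_sum_left[of _ B] unfolding inner_sum_right
      by (intro sum.cong refl) simp
    have "(\<Sum>y\<in>B. c y *\<^sub>R u y) = 0"
      using c(3) s1 unfolding u_def B_def
      by (simp add: scaleR_diff_right sum_subtractf flip: scaleR_sum_left)
    then have "0 = (\<Sum>y\<in>B. c y *\<^sub>R u y) \<bullet> (\<Sum>y\<in>B. c y *\<^sub>R u y)" by simp
    also have "\<dots> = (\<Sum>y\<in>B. \<Sum>w\<in>B. c y * c w * (u y \<bullet> u w))" by (rule sq)
    also have "\<dots> \<ge> (\<Sum>y\<in>B. \<Sum>w\<in>B. c y * c w * (v y \<bullet> v w + m))"
      using c(1) uv unfolding B_def by (intro sum_mono mult_left_mono) auto
    also have "(\<Sum>y\<in>B. \<Sum>w\<in>B. c y * c w * (v y \<bullet> v w + m)) =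
        (\<Sum>y\<in>B. c y *\<^sub>R v y) \<bullet> (\<Sum>y\<in>B. c y *\<^sub>R v y) + (\<Sum>y\<in>B. \<Sum>w\<in>B. c y * c w * m)"
      unfolding sq by (simp add: distrib_left sum.distrib)
    also have "(\<Sum>y\<in>B. \<Sum>w\<in>B. c y * c w * m) = m"
      using s1 by (simp flip: sum_distrib_left sum_distrib_right)
    finally show False using mpos inner_ge_zero[of "\<Sum>y\<in>B. c y *\<^sub>R v y"] by linarith
  qed
  then have "norm (q - x' i) \<le> norm (p - x i)" if "i \<in> I" for i
    using m(3)[OF that] unfolding h_def by (simp add: norm_le power2_norm_eq_inner)
  then show ?thesis using that by (auto simp: dist_norm)
qed

section \<open>Slender adornments\<close>

text \<open>The cross product of \<open>y - x\<close> and \<open>z - x\<close>: positive to the left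
  of the directed line from \<open>x\<close> to \<open>y\<close>, zero on it.\<close>

definition side :: "complex \<Rightarrow> complex \<Rightarrow> complex \<Rightarrow> real" where
  "side x y z = Im ((z - x) * cnj (y - x))"

definition half_lens :: "complex \<Rightarrow> complex \<Rightarrow> complex \<Rightarrow> complex set" where
  "half_lens x y p = {z. dist z x < dist p x \<and> dist z y < dist p y \<and> 0 < side x y p * side x y z}"

text \<open>Coordinates in which the base is the unit interval of the first axis.\<close>

definition pt :: "complex \<Rightarrow> complex \<Rightarrow> real \<Rightarrow> real \<Rightarrow> complex" where
  "pt x y u h = x + Complex u h * (y - x)"

lemma pt_cases:
  assumes "x \<noteq> y"
  obtains u h where "z = pt x y u h"
proof
  show "z = pt x y (Re ((z - x) / (y - x))) (Im ((z - x) / (y - x)))"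
    using assms by (simp add: pt_def)
qed

lemma dist_pt_left: "dist (pt x y u h) x = dist x y * sqrt (u\<^sup>2 + h\<^sup>2)"
  by (simp add: pt_def dist_norm norm_mult complex_norm norm_minus_commute mult.commute)

lemma dist_pt_right: "dist (pt x y u h) y = dist x y * sqrt ((1 - u)\<^sup>2 + h\<^sup>2)"
proof -
  have "pt x y u h - y = Complex (u - 1) h * (y - x)"
    by (simp add: pt_def complex_eq_iff algebra_simps)
  then have "dist (pt x y u h) y = cmod (Complex (u - 1) h) * dist x y"
    by (simp add: dist_norm norm_mult norm_minus_commute)
  then show ?thesis by (simp add: complex_norm power2_commute mult.commute)
qed

lemma side_pt: "side x y (pt x y u h) = (dist x y)\<^sup>2 * h"
proof -
  have "(pt x y u h - x) * cnj (y - x) = Complex u h * of_real ((cmod (y - x))\<^sup>2)"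
    unfolding pt_def complex_norm_square by (simp add: mult.assoc)
  then show ?thesis
    unfolding side_def by (simp add: dist_norm norm_minus_commute mult.commute)
qed

lemma continuous_on_pt [continuous_intros]:
  "continuous_on T u \<Longrightarrow> continuous_on T h \<Longrightarrow> continuous_on T (\<lambda>t. pt x y (u t) (h t))"
  unfolding pt_def Complex_eq by (intro continuous_intros)

lemma continuous_on_side [continuous_intros]:
  "continuous_on T x \<Longrightarrow> continuous_on T y \<Longrightarrow> continuous_on T z \<Longrightarrow>
    continuous_on T (\<lambda>t. side (x t) (y t) (z t))"
  unfolding side_def by (intro continuous_intros)

lemma pt_in_closed_segment: "0 \<le> u \<Longrightarrow> u \<le> 1 \<Longrightarrow> pt x y u 0 \<in> closed_segment x y"
  unfolding closed_segment_def pt_def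
  by (auto intro!: exI[of _ u] simp: complex_eq_iff algebra_simps)

lemma side_closed_segment:
  assumes "z \<in> closed_segment x y"
  shows "side x y z = 0"
proof -
  obtain u where "z = pt x y u 0"
    using assms unfolding closed_segment_def pt_def by (auto simp: complex_eq_iff algebra_simps)
  then show ?thesis by (simp add: side_pt)
qed

text \<open>On the line of the base the coordinate satisfies both
  \<open>\<bar>u\<bar> \<le> 1\<close> and \<open>\<bar>1 - u\<bar> \<le> 1\<close>, hence lies
  between 0 and 1. This turns a vanishing \<open>side\<close> into contact with a bar.\<close>

lemma mem_closed_segment_if_side_eq_0:
  assumes "x \<noteq> y" "dist z x \<le> dist x y" "dist z y \<le> dist x y" "side x y z = 0"
  shows "z \<in> closed_segment x y"
proof -
  obtain u h where z: "z = pt x y u h" using pt_cases[OF assms(1)] .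
  have h: "h = 0" using assms(1,4) by (simp add: z side_pt)
  have "\<bar>u\<bar> \<le> 1" "\<bar>1 - u\<bar> \<le> 1"
    using assms by (auto simp: z h dist_pt_left dist_pt_right)
  then show ?thesis using pt_in_closed_segment[of u x y] z h by auto
qed

section \<open>Distances to the ends of the base in a slender adornment\<close>

lemma slender_adornmentD:
  assumes "slender_adornment S x y"
  shows "compact S" "simply_connected S" "x \<noteq> y" "x \<in> frontier S" "y \<in> frontier S"
    "closed_segment x y \<subseteq> S" "frontier S \<subseteq> S"
  using assms unfolding slender_adornment_def adornment_def
  by (auto simp: compact_imp_closed frontier_subset_eq)

text \<open>Two frontier points that are strictly ordered with respect to both distances lie on
  different sides, and there are only two sides.\<close>

lemma slender_frontier_no_chain:
  assumes S: "slender_adornment S x y"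
    and F: "a \<in> frontier S" "b \<in> frontier S" "c \<in> frontier S"
    and ab: "dist a x < dist b x" "dist a y < dist b y"
    and bc: "dist b x < dist c x" "dist b y < dist c y"
  shows False
proof -
  obtain g1 g2 where g: "frontier S = path_image g1 \<union> path_image g2"
      "slender_side x y g1" "slender_side x y g2"
    using S unfolding slender_adornment_def by blast
  have no: "\<not> (p \<in> path_image g \<and> q \<in> path_image g)"
    if sl: "slender_side x y g" and lt: "dist p x < dist q x" "dist p y < dist q y" for p q g
  proof
    assume "p \<in> path_image g \<and> q \<in> path_image g"
    then obtain s s' where s: "s \<in> {0..1}" "s' \<in> {0..1}" "p = g s" "q = g s'"
      unfolding path_image_def by auto
    show False
    proof (cases "s \<le> s'")
      case True
      then show False using sl lt s unfolding slender_side_def by fastforce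
    next
      case False
      then show False using sl lt s unfolding slender_side_def by fastforce
    qed
  qed
  have ac: "dist a x < dist c x" "dist a y < dist c y" using ab bc by linarith+
  show False using no[OF g(2) ab] no[OF g(3) ab] no[OF g(2) bc] no[OF g(3) bc]
      no[OF g(2) ac] no[OF g(3) ac] F unfolding g(1) by blast
qed

lemma slender_frontier_dist_le:
  assumes S: "slender_adornment S x y" and f: "f \<in> frontier S"
  shows "dist f x \<le> dist x y \<and> dist f y \<le> dist x y"
proof -
  obtain g1 g2 where g: "frontier S = path_image g1 \<union> path_image g2"
      "slender_side x y g1" "slender_side x y g2" "is_side x y g1" "is_side x y g2"
    using S unfolding slender_adornment_def by blast
  have "dist f x \<le> dist x y \<and> dist f y \<le> dist x y"
    if sl: "slender_side x y g" and si: "is_side x y g" and fg: "f \<in> path_image g" for g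
  proof -
    obtain s where s: "s \<in> {0..1}" "f = g s" using fg unfolding path_image_def by auto
    have e: "g 0 = x" "g 1 = y"
      using si unfolding is_side_def pathstart_def pathfinish_def by auto
    have "dist (g s) x \<le> dist (g 1) x" "dist (g s) y \<le> dist (g 0) y"
      using sl s unfolding slender_side_def by auto
    then show ?thesis using e s by (simp add: dist_commute)
  qed
  then show ?thesis using g f by blast
qed

text \<open>A ray perpendicular to the base is connected and unbounded, so it must cross the
  frontier when it leaves \<open>S\<close>.\<close>

lemma compact_vertical_exit:
  assumes "compact S" "x \<noteq> y" "pt x y u h \<in> S" and \<sigma>: "\<bar>\<sigma>\<bar> = 1"
  obtains j where "0 \<le> j" "pt x y u (h + \<sigma> * j) \<in> frontier S"
proof -
  define R where "R = (\<lambda>j. pt x y u (h + \<sigma> * j)) ` {0..}"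
  have D: "0 < dist x y" using assms by simp
  obtain B where B: "\<And>z. z \<in> S \<Longrightarrow> dist z x \<le> B"
    using compact_imp_bounded[OF assms(1)] unfolding bounded_any_center[where a = x]
    by (auto simp: dist_commute)
  have B0: "0 \<le> B" using B[OF assms(3)] zero_le_dist order_trans by blast
  define j where "j = \<bar>h\<bar> + B / dist x y + 1"
  have j: "0 \<le> j" unfolding j_def using D B0 by simp
  have "B / dist x y < \<bar>\<sigma> * j\<bar> - \<bar>h\<bar>"
    unfolding abs_mult \<sigma> using j unfolding j_def by simp
  also have "\<dots> \<le> \<bar>h + \<sigma> * j\<bar>" by linarith
  also have "\<dots> \<le> sqrt (u\<^sup>2 + (h + \<sigma> * j)\<^sup>2)" by simp
  finally have "B < dist (pt x y u (h + \<sigma> * j)) x"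
    using D by (simp add: dist_pt_left field_simps)
  then have "pt x y u (h + \<sigma> * j) \<in> R - S" using B j unfolding R_def by force
  moreover have "connected R"
    unfolding R_def by (intro connected_continuous_image continuous_intros) simp
  moreover have "pt x y u h \<in> R \<inter> S"
    unfolding R_def using assms(3) by (auto intro!: image_eqI[of _ _ 0])
  ultimately have "R \<inter> frontier S \<noteq> {}" by (intro connected_Int_frontier) auto
  then show ?thesis unfolding R_def using that by auto
qed

text \<open>Moving perpendicularly away from the line of the base increases both distances, so the
  bound for frontier points passes to all of \<open>S\<close>.\<close>

lemma slender_dist_le:
  assumes S: "slender_adornment S x y" and z: "z \<in> S"
  shows "dist z x \<le> dist x y" "dist z y \<le> dist x y"
proof -
  note SD = slender_adornmentD[OF S]
  obtain u h where zu: "z = pt x y u h" using pt_cases[OF SD(3)] .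
  define \<sigma> :: real where "\<sigma> = (if 0 \<le> h then 1 else - 1)"
  have "\<bar>\<sigma>\<bar> = 1" unfolding \<sigma>_def by simp
  then obtain j where j: "0 \<le> j" "pt x y u (h + \<sigma> * j) \<in> frontier S"
    using compact_vertical_exit[OF SD(1) SD(3) z[unfolded zu]] by blast
  have "h\<^sup>2 \<le> (h + \<sigma> * j)\<^sup>2"
    unfolding abs_le_square_iff[symmetric] \<sigma>_def using j(1) by auto
  then have "dist z x \<le> dist (pt x y u (h + \<sigma> * j)) x" "dist z y \<le> dist (pt x y u (h + \<sigma> * j)) y"
    by (auto simp: zu dist_pt_left dist_pt_right intro!: mult_left_mono)
  then show "dist z x \<le> dist x y" "dist z y \<le> dist x y"
    using slender_frontier_dist_le[OF S j(2)] by linarith+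
qed

lemma slender_mem_base:
  assumes S: "slender_adornment S x y" and z: "z \<in> S" "side x y z = 0"
  shows "z \<in> closed_segment x y"
  using mem_closed_segment_if_side_eq_0 slender_dist_le[OF S z(1)] slender_adornmentD(3)[OF S] z(2)
  by blast

section \<open>Half lenses inside slender adornments\<close>

lemma open_half_lens: "open (half_lens x y p)"
  unfolding half_lens_def by (intro open_Collect_conj open_Collect_less continuous_intros)

lemma pt_mem_half_lens_iff:
  assumes "x \<noteq> y"
  shows "pt x y v k \<in> half_lens x y (pt x y u h) \<longleftrightarrow>
    v\<^sup>2 + k\<^sup>2 < u\<^sup>2 + h\<^sup>2 \<and> (1 - v)\<^sup>2 + k\<^sup>2 < (1 - u)\<^sup>2 + h\<^sup>2 \<and> 0 < h * k"
proof -
  have "0 < side x y (pt x y u h) * side x y (pt x y v k) \<longleftrightarrow> 0 < h * k"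
    using assms by (auto simp: side_pt zero_less_mult_iff mult_less_0_iff)
  then show ?thesis
    unfolding half_lens_def using assms by (simp add: dist_pt_left dist_pt_right)
qed

lemma path_meets_frontier:
  fixes f :: "real \<Rightarrow> 'a::topological_space"
  assumes "continuous_on {0..1} f" "f 0 \<in> S \<longleftrightarrow> f 1 \<notin> S"
  obtains t where "0 \<le> t" "t \<le> 1" "f t \<in> frontier S"
proof -
  have "connected (f ` {0..1})" using assms(1) by (intro connected_continuous_image) auto
  moreover have "f 0 \<in> f ` {0..1}" "f 1 \<in> f ` {0..1}" by auto
  ultimately have "f ` {0..1} \<inter> frontier S \<noteq> {}"
    using assms(2) by (intro connected_Int_frontier) blast+
  then show ?thesis using that by auto
qed

text \<open>If \<open>z \<in> half_lens x y p\<close> were outside \<open>S\<close>, then going from \<open>z\<close> down to the base, from \<open>z\<close> to \<open>p\<close>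
  with both distances growing, and from \<open>p\<close> upwards would produce a chain of three frontier points.\<close>

lemma half_lens_interior_point_subset:
  assumes S: "slender_adornment S x y" and p: "p \<in> interior S"
  shows "half_lens x y p \<subseteq> S"
proof (rule subsetI, rule ccontr)
  fix z assume z: "z \<in> half_lens x y p" and zS: "z \<notin> S"
  note SD = slender_adornmentD[OF S]
  have D: "0 < dist x y" using SD(3) by simp
  have pS: "p \<in> S" using p interior_subset by blast
  obtain u h where pu: "p = pt x y u h" using pt_cases[OF SD(3)] .
  obtain v k where zv: "z = pt x y v k" using pt_cases[OF SD(3)] .
  have le: "v\<^sup>2 + k\<^sup>2 < u\<^sup>2 + h\<^sup>2" "(1 - v)\<^sup>2 + k\<^sup>2 < (1 - u)\<^sup>2 + h\<^sup>2" and hk: "0 < h * k"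
    using z unfolding pu zv pt_mem_half_lens_iff[OF SD(3)] by auto
  have "u\<^sup>2 + h\<^sup>2 \<le> 1" "(1 - u)\<^sup>2 + h\<^sup>2 \<le> 1"
    using slender_dist_le[OF S pS] D by (simp_all add: pu dist_pt_left dist_pt_right)
  then have "v\<^sup>2 < 1" "(1 - v)\<^sup>2 < 1"
    using le zero_le_power2[of k] by linarith+
  then have v: "0 \<le> v" "v \<le> 1" by (auto simp: abs_square_less_1)
  define \<sigma> where "\<sigma> = sgn k"
  have \<sigma>: "\<bar>\<sigma>\<bar> = 1" "\<sigma> * \<bar>k\<bar> = k" "\<sigma> * \<bar>h\<bar> = h" "h = \<bar>h\<bar> * \<sigma>" "\<sigma> * \<sigma> = 1"
    using hk unfolding \<sigma>_def by (auto simp: zero_less_mult_iff sgn_if)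
  have "pt x y v (0 * k) \<in> S" "pt x y v (1 * k) \<notin> S"
    using pt_in_closed_segment[OF v] SD(6) zS zv by auto
  moreover have "continuous_on {0..1} (\<lambda>t. pt x y v (t * k))" by (intro continuous_intros)
  ultimately obtain t where t: "0 \<le> t" "t \<le> 1" and f1: "pt x y v (t * k) \<in> frontier S"
    using path_meets_frontier[of "\<lambda>t. pt x y v (t * k)" S] by blast
  have "t \<noteq> 1" using f1 SD(7) zS zv by auto
  then have tk: "(t * k)\<^sup>2 < k\<^sup>2"
  proof -
    have "t\<^sup>2 < 1" using t \<open>t \<noteq> 1\<close> by (simp add: abs_square_less_1)
    moreover have "0 < k\<^sup>2" using hk by auto
    ultimately show ?thesis
      using mult_strict_right_mono[of "t\<^sup>2" 1 "k\<^sup>2"] by (simp add: power_mult_distrib)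
  qed
  text \<open>Both squared distances are affine in the parameter along this curve.\<close>
  define c where "c s = v + s * (u - v)" for s
  define r where "r s = (v\<^sup>2 + k\<^sup>2) + s * (u\<^sup>2 + h\<^sup>2 - (v\<^sup>2 + k\<^sup>2))" for s
  \<comment> \<open>\<open>r s - (c s)\<^sup>2\<close> is the squared height on the curve: an
    interpolation of the two squared heights plus a nonnegative variance term.\<close>
  have nonneg: "0 \<le> r s - (c s)\<^sup>2" if "0 \<le> s" "s \<le> 1" for s
  proof -
    have "r s - (c s)\<^sup>2 = (1 - s) * k\<^sup>2 + s * h\<^sup>2 + s * (1 - s) * (u - v)\<^sup>2"
      unfolding r_def c_def by algebra
    then show ?thesis using that by simp
  qed
  have "continuous_on {0..1} (\<lambda>s. pt x y (c s) (\<sigma> * sqrt (r s - (c s)\<^sup>2)))"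
    unfolding c_def r_def by (intro continuous_intros)
  moreover have "pt x y (c 0) (\<sigma> * sqrt (r 0 - (c 0)\<^sup>2)) = z"
    unfolding c_def r_def using \<sigma> by (simp add: zv)
  moreover have "pt x y (c 1) (\<sigma> * sqrt (r 1 - (c 1)\<^sup>2)) = p"
    unfolding c_def r_def using \<sigma> by (simp add: pu)
  ultimately obtain s where s: "0 \<le> s" "s \<le> 1"
      and f2: "pt x y (c s) (\<sigma> * sqrt (r s - (c s)\<^sup>2)) \<in> frontier S"
    using zS pS path_meets_frontier[of "\<lambda>s. pt x y (c s) (\<sigma> * sqrt (r s - (c s)\<^sup>2))" S] by auto
  define e where "e = \<sigma> * sqrt (r s - (c s)\<^sup>2)"
  have e: "e\<^sup>2 = r s - (c s)\<^sup>2"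
  proof -
    have "\<sigma>\<^sup>2 = 1" using \<sigma>(5) by (simp add: power2_eq_square)
    then show ?thesis using nonneg[OF s] by (simp add: e_def power_mult_distrib)
  qed
  have e1: "(c s)\<^sup>2 + e\<^sup>2 = (1 - s) * (v\<^sup>2 + k\<^sup>2) + s * (u\<^sup>2 + h\<^sup>2)"
    unfolding e r_def by algebra
  have e2: "(1 - c s)\<^sup>2 + e\<^sup>2 = (1 - s) * ((1 - v)\<^sup>2 + k\<^sup>2) + s * ((1 - u)\<^sup>2 + h\<^sup>2)"
    unfolding e r_def c_def by algebra
  have conv: "a \<le> (1 - s) * a + s * b \<and> (1 - s) * a + s * b \<le> b" if "a < b" for a b :: real
  proof -
    have "0 \<le> s * (b - a)" "0 \<le> (1 - s) * (b - a)" using s that by simp_all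
    then show ?thesis by (simp add: algebra_simps)
  qed
  obtain j where j: "0 \<le> j" and f3: "pt x y u (h + \<sigma> * j) \<in> frontier S"
    using compact_vertical_exit[OF SD(1) SD(3) pS[unfolded pu] \<sigma>(1)] by blast
  \<comment> \<open>This is where \<open>p\<close> has to be interior: a frontier point could itself
    be the exit, and the chain would not be strict at its upper end.\<close>
  have "j \<noteq> 0" using f3 p pu by (auto simp: frontier_def)
  then have "\<bar>h\<bar> < \<bar>\<bar>h\<bar> + j\<bar>" using j by simp
  also have "\<dots> = \<bar>h + \<sigma> * j\<bar>"
  proof -
    have "h + \<sigma> * j = (\<bar>h\<bar> + j) * \<sigma>" using \<sigma>(4) by (simp add: algebra_simps)
    then show ?thesis using \<sigma>(1) by (simp add: abs_mult)
  qed
  finally have hj: "h\<^sup>2 < (h + \<sigma> * j)\<^sup>2" by (simp add: abs_le_square_iff flip: not_le)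
  show False
    using slender_frontier_no_chain[OF S f1 f2[folded e_def] f3] conv[OF le(1)] conv[OF le(2)] tk hj D
    by (simp add: dist_pt_left dist_pt_right e1 e2)
qed

text \<open>The part of a side through \<open>p\<close> that runs above the base, closed up by a piece of the base,
  is a Jordan curve in \<open>S\<close>; simple connectedness puts its inside into \<open>S\<close>.\<close>

lemma slender_mem_closure_interior:
  assumes S: "slender_adornment S x y" and p: "p \<in> S" "side x y p \<noteq> 0"
  shows "p \<in> closure (interior S)"
proof (cases "p \<in> frontier S")
  case False
  then have "p \<in> interior S" using p(1) closure_subset unfolding frontier_def by blast
  then show ?thesis using closure_subset by blast
next
  case True
  note SD = slender_adornmentD[OF S]
  obtain g where g: "is_side x y g" "p \<in> path_image g" "path_image g \<subseteq> frontier S"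
    using S True unfolding slender_adornment_def by auto
  have "arc g" and g01: "g 0 = x" "g 1 = y"
    using g(1) unfolding is_side_def pathstart_def pathfinish_def by auto
  have gS: "g s \<in> S" if "s \<in> {0..1}" for s
    using g(3) SD(7) that unfolding path_image_def by blast
  obtain s0 where s0: "s0 \<in> {0..1}" "p = g s0" using g(2) unfolding path_image_def by auto
  define f where "f s = side x y (g s)" for s
  have gc: "continuous_on {0..1} g" using \<open>arc g\<close> arc_imp_path path_def by blast
  then have fc: "continuous_on {0..1} f" unfolding f_def by (intro continuous_intros)
  have f01: "f 0 = 0" "f 1 = 0" unfolding f_def g01 by (simp_all add: side_closed_segment)
  define Z where "Z u v = {s \<in> {u..v}. f s = 0}" for u v
  have cZ: "compact (Z u v)" if "{u..v} \<subseteq> {0..1}" for u v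
  proof -
    have "closed (Z u v)" unfolding Z_def
      using that by (intro continuous_closed_preimage_constant continuous_on_subset[OF fc]) auto
    moreover have "bounded (Z u v)" unfolding Z_def
      by (rule bounded_subset[OF bounded_closed_interval[of u v]]) auto
    ultimately show ?thesis by (simp add: compact_eq_bounded_closed)
  qed
  have "compact (Z 0 s0)" "0 \<in> Z 0 s0" "compact (Z s0 1)" "1 \<in> Z s0 1"
    using s0(1) f01 by (auto intro!: cZ) (auto simp: Z_def)
  \<comment> \<open>The last zero of \<open>f\<close> before \<open>s0\<close> and the first one
    after it, so that the arc in between meets the line of the base only at its two ends.\<close>
  then obtain a b where a: "a \<in> Z 0 s0" "\<And>s. s \<in> Z 0 s0 \<Longrightarrow> s \<le> a"
      and b: "b \<in> Z s0 1" "\<And>s. s \<in> Z s0 1 \<Longrightarrow> b \<le> s"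
    using compact_attains_sup[of "Z 0 s0"] compact_attains_inf[of "Z s0 1"] by blast
  have "f s0 \<noteq> 0" using p(2) s0(2) unfolding f_def by simp
  then have ab: "0 \<le> a" "a < s0" "s0 < b" "b \<le> 1" and fab: "f a = 0" "f b = 0"
    using a(1) b(1) unfolding Z_def by (auto simp: less_le)
  have nz: "f s \<noteq> 0" if "a < s" "s < b" for s
    using a(2)[of s] b(2)[of s] that ab unfolding Z_def by force
  have aI: "a \<in> {0..1}" and bI: "b \<in> {0..1}" using ab s0(1) by auto
  have "g a \<noteq> g b"
    using \<open>arc g\<close> ab aI bI unfolding arc_def inj_on_def by force
  define J where "J = subpath a b g +++ linepath (g b) (g a)"
  have img: "path_image (subpath a b g) = g ` {a..b}"
    using ab by (simp add: path_image_subpath)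
  have gab: "g a \<in> closed_segment x y" "g b \<in> closed_segment x y"
    using slender_mem_base[OF S gS[OF aI]] slender_mem_base[OF S gS[OF bI]] fab unfolding f_def by auto
  then have seg: "closed_segment (g b) (g a) \<subseteq> closed_segment x y"
    by (simp add: subset_closed_segment)
  have "simple_path J"
    unfolding J_def
  proof (rule simple_path_join_loop)
    show "arc (subpath a b g)"
      using \<open>arc g\<close> aI bI ab by (intro arc_subpath_arc) auto
    show "arc (linepath (g b) (g a))" using \<open>g a \<noteq> g b\<close> by simp
    show "path_image (subpath a b g) \<inter> path_image (linepath (g b) (g a))
        \<subseteq> {pathstart (subpath a b g), pathstart (linepath (g b) (g a))}"
    proof
      fix w assume "w \<in> path_image (subpath a b g) \<inter> path_image (linepath (g b) (g a))"
      then obtain s where "s \<in> {a..b}" and w: "w = g s" "w \<in> closed_segment x y"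
        using seg unfolding img path_image_linepath by blast
      then have s: "a \<le> s" "s \<le> b" by auto
      have "f s = 0" using w unfolding f_def by (simp add: side_closed_segment)
      then have "s = a \<or> s = b" using nz[of s] s by linarith
      then show "w \<in> {pathstart (subpath a b g), pathstart (linepath (g b) (g a))}"
        using w(1) by auto
    qed
  qed auto
  moreover have loop: "pathfinish J = pathstart J" unfolding J_def by simp
  ultimately have jordan: "open (inside (path_image J))" "frontier (inside (path_image J)) = path_image J"
    using Jordan_inside_outside[of J] by auto
  have JS: "path_image J \<subseteq> S"
  proof -
    have "path_image J = g ` {a..b} \<union> closed_segment (g b) (g a)"
      unfolding J_def by (subst path_image_join) (auto simp: img)
    then show ?thesis using gS ab seg SD(6) by auto
  qed
  have "inside (path_image J) \<subseteq> S"
  proof (rule subsetI, rule ccontr)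
    fix z assume z: "z \<in> inside (path_image J)" "z \<notin> S"
    have "winding_number J z = 0"
      using simply_connected_imp_winding_number_zero[OF SD(2) _ JS loop z(2)]
        simple_path_imp_path[OF \<open>simple_path J\<close>] by blast
    moreover have "winding_number J z = 1 \<or> winding_number J z = - 1"
      using simple_closed_path_winding_number_inside[OF \<open>simple_path J\<close>] z(1) by metis
    ultimately show False by simp
  qed
  then have "inside (path_image J) \<subseteq> interior S" using jordan(1) interior_maximal by blast
  then have "frontier (inside (path_image J)) \<subseteq> closure (interior S)"
    unfolding frontier_def using closure_mono by blast
  moreover have "p \<in> path_image J"
    unfolding J_def using ab s0(2) by (subst path_image_join) (auto simp: img)
  ultimately show ?thesis using jordan(2) by blast
qed

text \<open>For fixed \<open>z\<close>, the condition \<open>z \<in> half_lens x y q\<close> is open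
  in \<open>q\<close>, so \<open>p\<close> may be replaced by an interior point of \<open>S\<close>
  nearby.\<close>

lemma slender_half_lens_subset_interior:
  assumes S: "slender_adornment S x y" and p: "p \<in> S"
  shows "half_lens x y p \<subseteq> interior S"
proof (rule interior_maximal[OF _ open_half_lens], rule subsetI)
  fix z assume z: "z \<in> half_lens x y p"
  then have "side x y p \<noteq> 0" unfolding half_lens_def by auto
  then have "p \<in> closure (interior S)" using slender_mem_closure_interior[OF S p] by simp
  moreover have "open {q. z \<in> half_lens x y q}"
    unfolding half_lens_def mem_Collect_eq
    by (intro open_Collect_conj open_Collect_less continuous_intros)
  ultimately obtain q where "q \<in> interior S" "z \<in> half_lens x y q"
    using z open_Int_closure_eq_empty[of "{q. z \<in> half_lens x y q}" "interior S"] by blast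
  then show "z \<in> S" using half_lens_interior_point_subset[OF S] by blast
qed

section \<open>Two bars in an expansive motion\<close>

text \<open>Unlike in \<open>half_lens\<close>, radii and side are separated from the point defining
  them, so they can be kept while \<open>x\<close> and \<open>y\<close> move. Only the sign of
  \<open>k\<close> matters.\<close>

definition half_disc_lens :: "real \<Rightarrow> real \<Rightarrow> real \<Rightarrow> complex \<Rightarrow> complex \<Rightarrow> complex set" where
  "half_disc_lens r1 r2 k x y = {z. dist z x < r1 \<and> dist z y < r2 \<and> 0 < k * side x y z}"

lemma side_add: "side x y (z + w) = side x y z + Im (w * cnj (y - x))"
  unfolding side_def by (simp add: algebra_simps)

lemma ex_negative_side_nearby:
  assumes "open U" "q \<in> U" "k \<noteq> 0" "x \<noteq> y" "k * side x y q = 0"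
  obtains z where "z \<in> U" "k * side x y z < 0"
proof -
  \<comment> \<open>\<open>\<i> * (y - x)\<close> is normal to the base and points to its positive
    side; the factor \<open>- k\<close> selects the direction in which \<open>k * side x y\<close>
    decreases.\<close>
  define v where "v = - of_real k * \<i> * (y - x)"
  obtain e where e: "e > 0" "ball q e \<subseteq> U" using assms(1,2) open_contains_ball by blast
  have "v \<noteq> 0" using assms unfolding v_def by auto
  define d where "d = e / (2 * norm v)"
  have d: "0 < d" "d * norm v < e" using e \<open>v \<noteq> 0\<close> unfolding d_def by auto
  have "q + of_real d * v \<in> U"
    using e(2) d by (intro subsetD[OF e(2)]) (simp add: dist_norm norm_mult)
  moreover have "Im (of_real d * v * cnj (y - x)) = - d * k * (dist x y)\<^sup>2"
  proof -
    have "of_real d * v * cnj (y - x) = of_real (- d * k * (cmod (y - x))\<^sup>2) * \<i>"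
      unfolding v_def of_real_mult complex_norm_square by simp
    then show ?thesis by (simp add: dist_norm norm_minus_commute)
  qed
  then have "k * side x y (q + of_real d * v) = - (d * k\<^sup>2 * (dist x y)\<^sup>2)"
    using assms(5) unfolding side_add distrib_left by (simp add: power2_eq_square)
  then have "k * side x y (q + of_real d * v) < 0" using d assms by simp
  ultimately show ?thesis using that by blast
qed

text \<open>The parts of the motion that concern two distinct bars. \<open>hinge\<close> records
  combinatorial incidence: an initial coincidence comes from a shared vertex and therefore
  persists.\<close>

locale expansive_pair =
  fixes x y x' y' :: "real \<Rightarrow> complex"
  assumes cont: "continuous_on {0..1} x" "continuous_on {0..1} y"
      "continuous_on {0..1} x'" "continuous_on {0..1} y'"
    and nondeg: "x 0 \<noteq> y 0" "x' 0 \<noteq> y' 0"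
    and rigid: "\<And>t. t \<in> {0..1} \<Longrightarrow> dist (x t) (y t) = dist (x 0) (y 0)"
      "\<And>t. t \<in> {0..1} \<Longrightarrow> dist (x' t) (y' t) = dist (x' 0) (y' 0)"
    and expand: "\<And>s t u u'. 0 \<le> s \<Longrightarrow> s \<le> t \<Longrightarrow> t \<le> 1 \<Longrightarrow> u \<in> {0..1} \<Longrightarrow> u' \<in> {0..1} \<Longrightarrow>
      dist (linepath (x s) (y s) u) (linepath (x' s) (y' s) u')
        \<le> dist (linepath (x t) (y t) u) (linepath (x' t) (y' t) u')"
    and hinge: "\<And>u u'. u \<in> {0..1} \<Longrightarrow> u' \<in> {0..1} \<Longrightarrow>
      linepath (x 0) (y 0) u = linepath (x' 0) (y' 0) u' \<Longrightarrow>
      u \<in> {0, 1} \<and> u' \<in> {0, 1} \<and>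
        (\<forall>t\<in>{0..1}. linepath (x t) (y t) u = linepath (x' t) (y' t) u')"
begin

lemma swap: "expansive_pair x' y' x y"
proof
  show "dist (linepath (x' s) (y' s) u) (linepath (x s) (y s) u')
      \<le> dist (linepath (x' t) (y' t) u) (linepath (x t) (y t) u')"
    if "0 \<le> s" "s \<le> t" "t \<le> 1" "u \<in> {0..1}" "u' \<in> {0..1}" for s t u u'
    using expand[of s t u' u] that by (simp add: dist_commute)
  show "u \<in> {0, 1} \<and> u' \<in> {0, 1} \<and>
      (\<forall>t\<in>{0..1}. linepath (x' t) (y' t) u = linepath (x t) (y t) u')"
    if "u \<in> {0..1}" "u' \<in> {0..1}" "linepath (x' 0) (y' 0) u = linepath (x 0) (y 0) u'" for u u'
    using hinge[of u' u] that by auto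
qed (rule cont nondeg rigid | assumption)+

lemma nondeg_t:
  assumes "t \<in> {0..1}"
  shows "x t \<noteq> y t" "x' t \<noteq> y' t"
  using rigid[OF assms] nondeg by auto

lemma expand_vertices:
  assumes "0 \<le> s" "s \<le> t" "t \<le> 1"
  shows "dist (x s) (x' s) \<le> dist (x t) (x' t)" "dist (x s) (y' s) \<le> dist (x t) (y' t)"
    "dist (y s) (x' s) \<le> dist (y t) (x' t)" "dist (y s) (y' s) \<le> dist (y t) (y' t)"
  using expand[OF assms, of 0 0] expand[OF assms, of 0 1] expand[OF assms, of 1 0]
    expand[OF assms, of 1 1] by (auto simp: linepath_0' linepath_1')

text \<open>Distances never shrink in forward time, so points that coincide at time \<open>t\<close>
  already coincide at time 0.\<close>

lemma meet_imp_hinge: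
  assumes "t \<in> {0..1}" "u \<in> {0..1}" "u' \<in> {0..1}"
    and "linepath (x t) (y t) u = linepath (x' t) (y' t) u'"
  shows "u \<in> {0, 1} \<and> u' \<in> {0, 1} \<and>
    (\<forall>t\<in>{0..1}. linepath (x t) (y t) u = linepath (x' t) (y' t) u')"
proof -
  have "linepath (x 0) (y 0) u = linepath (x' 0) (y' 0) u'"
    using expand[of 0 t u u'] assms by auto
  then show ?thesis using hinge assms(2,3) by blast
qed

lemma bar_point_in_half_disc_lens_earlier:
  assumes st: "0 \<le> s" "s \<le> t" "t \<le> 1" and u: "u \<in> {0..1}"
    and r: "r1 \<le> dist (x 0) (y 0)" "r2 \<le> dist (x 0) (y 0)"
    and w: "linepath (x' t) (y' t) u \<in> half_disc_lens r1 r2 k (x t) (y t)"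
  shows "linepath (x' s) (y' s) u \<in> half_disc_lens r1 r2 k (x s) (y s)"
proof -
  define p where "p v = linepath (x' v) (y' v) u" for v
  define f where "f v = k * side (x v) (y v) (p v)" for v
  have ft: "0 < f t" "k \<noteq> 0" using w unfolding half_disc_lens_def f_def p_def by auto
  have d: "dist (p v) (x v) < r1 \<and> dist (p v) (y v) < r2" if v: "s \<le> v" "v \<le> t" for v
  proof -
    have "dist (x v) (p v) \<le> dist (x t) (p t)" "dist (y v) (p v) \<le> dist (y t) (p t)"
      using expand[of v t 0 u] expand[of v t 1 u] st v u by (auto simp: p_def linepath_0' linepath_1')
    then show ?thesis using w unfolding half_disc_lens_def p_def by (auto simp: dist_commute)
  qed
  have "0 < f s"
  proof (rule ccontr)
    assume "\<not> 0 < f s"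
    moreover have "continuous_on {s..t} f"
      unfolding f_def p_def linepath_def using st
      by (intro continuous_intros continuous_on_subset[OF cont(1)] continuous_on_subset[OF cont(2)]
          continuous_on_subset[OF cont(3)] continuous_on_subset[OF cont(4)]) auto
    ultimately obtain v where v: "s \<le> v" "v \<le> t" "f v = 0"
      using IVT'[of f s 0 t] ft(1) st by auto
    have vI: "v \<in> {0..1}" using v st by auto
    have "side (x v) (y v) (p v) = 0" using v(3) ft(2) unfolding f_def by simp
    then have "p v \<in> closed_segment (x v) (y v)"
      using d[OF v(1,2)] r rigid(1)[OF vI] nondeg_t[OF vI]
      by (intro mem_closed_segment_if_side_eq_0) auto
    \<comment> \<open>At a change of side the point touches the other bar; such a contact is a hinge
      and persists until \<open>t\<close>, where \<open>side\<close> is nonzero.\<close>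
    then obtain u' where u': "u' \<in> {0..1}" "linepath (x v) (y v) u' = p v"
      unfolding linepath_image_01[symmetric] by auto
    have "linepath (x t) (y t) u' = p t"
      using meet_imp_hinge[OF vI u'(1) u] u'(2) st unfolding p_def by auto
    then have "p t \<in> closed_segment (x t) (y t)"
      using u'(1) linepath_in_path by metis
    then show False using ft(1) side_closed_segment unfolding f_def by auto
  qed
  then show ?thesis using d[of s] st unfolding half_disc_lens_def f_def p_def by auto
qed

lemma lenses_meet_earlier:
  assumes st: "0 \<le> s" "s \<le> t" "t \<le> 1"
    and z: "dist z (x t) < r1" "dist z (y t) < r2" "dist z (x' t) < r1'" "dist z (y' t) < r2'"
  obtains q where "dist q (x s) < r1" "dist q (y s) < r2" "dist q (x' s) < r1'" "dist q (y' s) < r2'"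
proof -
  \<comment> \<open>The four disc centres as one indexed family: distances within a bar are
    constant, distances between the bars contract in reversed time.\<close>
  define c where "c v i = [x v, y v, x' v, y' v] ! i" for v and i :: nat
  have tI: "t \<in> {0..1}" "s \<in> {0..1}" using st by auto
  have "dist (c s i) (c s j) \<le> dist (c t i) (c t j)" if "i \<in> {0,1,2,3}" "j \<in> {0,1,2,3}" for i j
    using that expand_vertices[OF st] rigid(1)[OF tI(1)] rigid(1)[OF tI(2)] rigid(2)[OF tI(1)] rigid(2)[OF tI(2)]
    by (auto simp: c_def dist_commute numeral_2_eq_2 numeral_3_eq_3)
  then obtain q where q: "\<And>i. i \<in> {0,1,2,3} \<Longrightarrow> dist q (c s i) \<le> dist z (c t i)"
    using kirszbraun_finite[of "{0,1,2,3}" "c s" "c t" z] by blast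
  show ?thesis
    using that[of q] q[of 0] q[of 1] q[of 2] q[of 3] z
    by (simp add: c_def numeral_2_eq_2 numeral_3_eq_3)
qed

end

text \<open>\<open>bars_outside\<close> is required only at time 0; it extends to later times
  because a bar point in a half lens was already there at the start.\<close>

locale expansive_half_lenses = expansive_pair +
  fixes r1 r2 k r1' r2' k' :: real
  assumes radii: "r1 \<le> dist (x 0) (y 0)" "r2 \<le> dist (x 0) (y 0)"
      "r1' \<le> dist (x' 0) (y' 0)" "r2' \<le> dist (x' 0) (y' 0)"
    and k: "k \<noteq> 0" "k' \<noteq> 0"
    and bars_outside: "\<And>u. u \<in> {0..1} \<Longrightarrow> linepath (x 0) (y 0) u \<notin> half_disc_lens r1' r2' k' (x' 0) (y' 0)"
      "\<And>u. u \<in> {0..1} \<Longrightarrow> linepath (x' 0) (y' 0) u \<notin> half_disc_lens r1 r2 k (x 0) (y 0)"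
begin

lemma swap_half_lenses: "expansive_half_lenses x' y' x y r1' r2' k' r1 r2 k"
  unfolding expansive_half_lenses_def expansive_half_lenses_axioms_def
  using swap radii k bars_outside by blast

definition lenses :: "real \<Rightarrow> complex set" where
  "lenses t = {z. dist z (x t) < r1 \<and> dist z (y t) < r2 \<and> dist z (x' t) < r1' \<and> dist z (y' t) < r2'}"

definition half_lenses :: "real \<Rightarrow> complex set" where
  "half_lenses t = half_disc_lens r1 r2 k (x t) (y t) \<inter> half_disc_lens r1' r2' k' (x' t) (y' t)"

lemma mem_half_lenses_iff:
  "z \<in> half_lenses t \<longleftrightarrow>
    z \<in> lenses t \<and> 0 < k * side (x t) (y t) z \<and> 0 < k' * side (x' t) (y' t) z"
  unfolding half_lenses_def lenses_def half_disc_lens_def by auto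

text \<open>Such an \<open>e\<close> lies on the first bar. If it is strictly on the chosen side of
  the second, that bar point lies in a half lens, also at time 0. Otherwise \<open>e\<close> is on
  both bars, hence an end of the first, at full bar length from the other end and so outside the
  open lens.\<close>

lemma bar_avoids_half_lenses_boundary:
  assumes s: "s \<in> {0..1}" and e: "e \<in> lenses s"
    and e0: "k * side (x s) (y s) e = 0" and e1: "0 \<le> k' * side (x' s) (y' s) e"
  shows False
proof -
  have e': "dist e (x s) < r1" "dist e (y s) < r2" "dist e (x' s) < r1'" "dist e (y' s) < r2'"
    using e unfolding lenses_def by auto
  have "e \<in> closed_segment (x s) (y s)"
    using e' radii rigid(1)[OF s] nondeg_t[OF s] e0 k
    by (intro mem_closed_segment_if_side_eq_0) auto
  then obtain u where u: "u \<in> {0..1}" "linepath (x s) (y s) u = e"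
    unfolding linepath_image_01[symmetric] by auto
  show False
  proof (cases "k' * side (x' s) (y' s) e = 0")
    case True
    then have "e \<in> closed_segment (x' s) (y' s)"
      using e' radii rigid(2)[OF s] nondeg_t[OF s] k
      by (intro mem_closed_segment_if_side_eq_0) auto
    then obtain u' where u': "u' \<in> {0..1}" "linepath (x' s) (y' s) u' = e"
      unfolding linepath_image_01[symmetric] by auto
    have "u \<in> {0, 1}" using meet_imp_hinge[OF s u(1) u'(1)] u(2) u'(2) by auto
    then have "e = x s \<or> e = y s" using u(2) by (auto simp: linepath_0' linepath_1')
    then show False using e'(1,2) radii(1,2) rigid(1)[OF s] by (auto simp: dist_commute)
  next
    case False
    interpret sw: expansive_pair x' y' x y by (rule swap)
    have "linepath (x s) (y s) u \<in> half_disc_lens r1' r2' k' (x' s) (y' s)"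
      using False e1 e' unfolding half_disc_lens_def u(2) by (simp add: less_le)
    then have "linepath (x 0) (y 0) u \<in> half_disc_lens r1' r2' k' (x' 0) (y' 0)"
      using sw.bar_point_in_half_disc_lens_earlier[of 0 s u r1' r2' k'] s u(1) radii by auto
    then show False using bars_outside(1) u(1) by blast
  qed
qed

lemma convex_lenses: "convex (lenses t)"
proof -
  have "lenses t = ball (x t) r1 \<inter> ball (y t) r2 \<inter> ball (x' t) r1' \<inter> ball (y' t) r2'"
    unfolding lenses_def by (auto simp: dist_commute)
  then show ?thesis by (auto intro!: convex_Int)
qed

lemma open_lenses: "open (lenses t)"
  unfolding lenses_def by (intro open_Collect_conj open_Collect_less continuous_intros)

text \<open>Leaving the half lenses inside the lenses means crossing one of the two bars.\<close>

lemma lenses_subset_half_lenses: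
  assumes s: "s \<in> {0..1}" and z0: "z0 \<in> half_lenses s"
  shows "lenses s \<subseteq> half_lenses s"
proof (rule subsetI, rule ccontr)
  fix z1 assume z1: "z1 \<in> lenses s" "z1 \<notin> half_lenses s"
  have z0': "z0 \<in> lenses s" using z0 mem_half_lenses_iff by blast
  \<comment> \<open>A zero of the minimum is a point where one side vanishes while the other is
    still nonnegative, exactly the situation excluded above.\<close>
  define f where "f v = min (k * side (x s) (y s) (linepath z0 z1 v))
    (k' * side (x' s) (y' s) (linepath z0 z1 v))" for v
  have "continuous_on {0..1} f"
    unfolding f_def by (intro continuous_intros)
  moreover have "0 \<le> f 0" "f 1 \<le> 0"
    using z0 z1 unfolding f_def mem_half_lenses_iff by (auto simp: linepath_0' linepath_1')
  ultimately obtain v where v: "0 \<le> v" "v \<le> 1" "f v = 0"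
    using IVT2'[of f 1 0 0] by auto
  define e where "e = linepath z0 z1 v"
  have "e \<in> closed_segment z0 z1"
    using v unfolding e_def by (intro linepath_in_path) auto
  then have e: "e \<in> lenses s"
    using closed_segment_subset[OF z0' z1(1) convex_lenses] by blast
  interpret sw: expansive_half_lenses x' y' x y r1' r2' k' r1 r2 k by (rule swap_half_lenses)
  have e': "e \<in> sw.lenses s" using e unfolding lenses_def sw.lenses_def by auto
  have "min (k * side (x s) (y s) e) (k' * side (x' s) (y' s) e) = 0"
    using v(3) unfolding f_def e_def .
  then have "k * side (x s) (y s) e = 0 \<and> 0 \<le> k' * side (x' s) (y' s) e \<or>
      k' * side (x' s) (y' s) e = 0 \<and> 0 \<le> k * side (x s) (y s) e"
    by (auto simp: min_def split: if_splits)
  then show False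
    using bar_avoids_half_lenses_boundary[OF s e] sw.bar_avoids_half_lenses_boundary[OF s e'] by blast
qed

text \<open>The intersection of the lenses is nonempty at all earlier times (Kirszbraun), and lies either
  completely inside or completely outside the half lenses. Which of the two happens is locally
  constant in time.\<close>

lemma half_lenses_meet_at_start:
  assumes t: "t \<in> {0..1}" and z: "z \<in> half_lenses t"
  shows "half_lenses 0 \<noteq> {}"
proof -
  have sub: "{0..t} \<subseteq> {0..1}" using t by auto
  have lt: "\<forall>\<^sub>F s in at a within {0..t}. h s < c"
    if "continuous_on {0..1} h" "a \<in> {0..t}" "h a < c" for h :: "real \<Rightarrow> real" and a c
  proof -
    have "(h \<longlongrightarrow> h a) (at a within {0..t})"
      using continuous_on_subset[OF that(1) sub] that(2) unfolding continuous_on_def by blast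
    then show ?thesis using that(3) by (rule order_tendstoD(2))
  qed
  have ev_lenses: "\<forall>\<^sub>F s in at a within {0..t}. q \<in> lenses s"
    if "a \<in> {0..t}" "q \<in> lenses a" for a q
    using that unfolding lenses_def mem_Collect_eq
    by (intro eventually_conj lt continuous_intros cont) auto
  have sidec: "continuous_on {0..1} (\<lambda>s. c * side (x s) (y s) q)"
     "continuous_on {0..1} (\<lambda>s. c * side (x' s) (y' s) q)" for c q
    by (intro continuous_intros cont)+
  have loc: "\<forall>\<^sub>F s in at a within {0..t}. (half_lenses a = {}) = (half_lenses s = {})"
    if a: "a \<in> {0..t}" for a
  proof (cases "half_lenses a = {}")
    case False
    then obtain q where q: "q \<in> lenses a" "0 < k * side (x a) (y a) q" "0 < k' * side (x' a) (y' a) q"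
      using mem_half_lenses_iff by blast
    have "\<forall>\<^sub>F s in at a within {0..t}. - k * side (x s) (y s) q < 0"
      "\<forall>\<^sub>F s in at a within {0..t}. - k' * side (x' s) (y' s) q < 0"
      using q by (intro lt[OF sidec(1) a], simp, intro lt[OF sidec(2) a], simp)
    then show ?thesis
      using ev_lenses[OF a q(1)]
    proof eventually_elim
      case (elim s)
      then have "q \<in> half_lenses s" by (simp add: mem_half_lenses_iff)
      then show ?case using False by auto
    qed
  next
    case True
    have aI: "a \<in> {0..1}" using a sub by blast
    obtain q where q: "q \<in> lenses a"
      using lenses_meet_earlier[of a t z r1 r2 r1' r2'] a t z
      unfolding mem_half_lenses_iff lenses_def by auto
    \<comment> \<open>\<open>q\<close> may lie on the line of a bar, where its position is unstable
      in time. A nearby point strictly on a wrong side stays wrong for nearby times, and one such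
      point empties the half lenses.\<close>
    obtain p where p: "p \<in> lenses a" "k * side (x a) (y a) p < 0 \<or> k' * side (x' a) (y' a) p < 0"
    proof -
      consider "k * side (x a) (y a) q < 0 \<or> k' * side (x' a) (y' a) q < 0"
        | "k * side (x a) (y a) q = 0" | "k' * side (x' a) (y' a) q = 0"
        using True q mem_half_lenses_iff[of q a] by force
      then show ?thesis
        using that q ex_negative_side_nearby[OF open_lenses q k(1) nondeg_t(1)[OF aI]]
          ex_negative_side_nearby[OF open_lenses q k(2) nondeg_t(2)[OF aI]]
        by cases blast+
    qed
    have "\<forall>\<^sub>F s in at a within {0..t}. k * side (x s) (y s) p < 0 \<or> k' * side (x' s) (y' s) p < 0"
      using p(2)
    proof
      assume "k * side (x a) (y a) p < 0"
      from lt[OF sidec(1) a this] show ?thesis by eventually_elim blast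
    next
      assume "k' * side (x' a) (y' a) p < 0"
      from lt[OF sidec(2) a this] show ?thesis by eventually_elim blast
    qed
    moreover have "\<forall>\<^sub>F s in at a within {0..t}. s \<in> {0..t}"
      by (simp add: eventually_at_filter)
    ultimately show ?thesis
      using ev_lenses[OF a p(1)]
    proof eventually_elim
      case (elim s)
      have "p \<notin> half_lenses s" using elim(1) by (auto simp: mem_half_lenses_iff)
      then have "half_lenses s = {}"
        using lenses_subset_half_lenses[of s] elim(2,3) sub by blast
      then show ?case using True by simp
    qed
  qed
  have "(half_lenses 0 = {}) = (half_lenses t = {})"
    using t by (intro connected_local_const[OF _ _ _ ballI[OF loc]]) auto
  then show ?thesis using z by auto
qed

end

section \<open>Rigidly carried adornments\<close>

lemma half_lens_eq_half_disc_lens: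
  "half_lens x y p = half_disc_lens (dist p x) (dist p y) (side x y p) x y"
  unfolding half_lens_def half_disc_lens_def by simp

lemma rigid_to_pt:
  assumes "p0 \<noteq> q0"
  shows "rigid_to p0 q0 p q (pt p0 q0 u h) = pt p q u h"
  using assms unfolding rigid_to_def pt_def by (simp add: field_simps)

lemma rigid_to_preserves:
  assumes "p0 \<noteq> q0" "dist p q = dist p0 q0"
  shows "dist (rigid_to p0 q0 p q z) p = dist z p0" "dist (rigid_to p0 q0 p q z) q = dist z q0"
    "side p q (rigid_to p0 q0 p q z) = side p0 q0 z"
proof -
  obtain u h where "z = pt p0 q0 u h" using pt_cases[OF assms(1)] .
  then show "dist (rigid_to p0 q0 p q z) p = dist z p0" "dist (rigid_to p0 q0 p q z) q = dist z q0"
    "side p q (rigid_to p0 q0 p q z) = side p0 q0 z"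
    using assms by (simp_all add: rigid_to_pt dist_pt_left dist_pt_right side_pt)
qed

lemma rigid_to_mem_half_disc_lens_iff:
  assumes "p0 \<noteq> q0" "dist p q = dist p0 q0"
  shows "rigid_to p0 q0 p q z \<in> half_disc_lens r1 r2 k p q \<longleftrightarrow> z \<in> half_disc_lens r1 r2 k p0 q0"
  unfolding half_disc_lens_def by (simp add: rigid_to_preserves[OF assms])

lemma rigid_to_linepath:
  assumes "p0 \<noteq> q0"
  shows "rigid_to p0 q0 p q (linepath p0 q0 u) = linepath p q u"
proof -
  have "linepath a b u = pt a b u 0" for a b
    unfolding linepath_def pt_def by (simp add: complex_eq_iff algebra_simps)
  then show ?thesis using rigid_to_pt[OF assms] by simp
qed

lemma mem_interior_rigid_to_image:
  assumes "p0 \<noteq> q0" "p \<noteq> q" and w: "w \<in> interior (rigid_to p0 q0 p q ` S)"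
  obtains z where "z \<in> interior S" "w = rigid_to p0 q0 p q z"
proof -
  let ?R = "rigid_to p0 q0 p q"
  have inj: "inj ?R" using assms unfolding rigid_to_def by (auto intro!: injI)
  have "continuous_on UNIV ?R"
    unfolding rigid_to_def using assms by (intro continuous_intros) auto
  then have "open (?R -` interior (?R ` S))" by (simp add: open_vimage)
  moreover have "?R -` interior (?R ` S) \<subseteq> S"
    using interior_subset[of "?R ` S"] inj by (auto dest: injD)
  ultimately have "?R -` interior (?R ` S) \<subseteq> interior S" by (rule interior_maximal[rotated])
  moreover obtain z where "w = ?R z" using w interior_subset by blast
  ultimately show ?thesis using that w by blast
qed

text \<open>Scaling the height of \<open>q\<close> by a factor slightly above or below 1 moves both
  distances in the same direction and keeps the side.\<close>

lemma half_lens_nearby: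
  assumes "x \<noteq> y" "side x y q \<noteq> 0" "open U" "q \<in> U"
  shows "\<exists>z\<in>U. q \<in> half_lens x y z" "\<exists>z\<in>U. z \<in> half_lens x y q"
proof -
  obtain u h where q: "q = pt x y u h" using pt_cases[OF assms(1)] .
  have h: "h \<noteq> 0" using assms(1,2) by (auto simp: q side_pt)
  have "open ((\<lambda>t. pt x y u (t * h)) -` U)"
    using assms(3) by (intro open_vimage continuous_intros)
  moreover have "1 \<in> (\<lambda>t. pt x y u (t * h)) -` U" using assms(4) q by simp
  ultimately obtain e where e: "e > 0" "\<And>t. dist t 1 < e \<Longrightarrow> pt x y u (t * h) \<in> U"
    unfolding open_dist by blast
  define d where "d = min (e / 2) (1 / 2)"
  have d: "0 < d" "d < 1" "d < e" using e(1) unfolding d_def by auto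
  have h2: "0 < h\<^sup>2" using h by simp
  have hc: "0 < h * (c * h)" "0 < c * h * h" if "0 < c" for c
  proof -
    have "0 < c * h\<^sup>2" using h that by simp
    then show "0 < h * (c * h)" "0 < c * h * h" by (simp_all add: power2_eq_square mult_ac)
  qed
  have sq: "1 < (1 + d)\<^sup>2" "(1 - d)\<^sup>2 < 1"
    using d by (simp_all add: abs_square_less_1 one_less_power)
  have up: "h\<^sup>2 < ((1 + d) * h)\<^sup>2" and down: "((1 - d) * h)\<^sup>2 < h\<^sup>2"
    using mult_strict_right_mono[OF sq(1) h2] mult_strict_right_mono[OF sq(2) h2]
    by (simp_all add: power_mult_distrib)
  have "q \<in> half_lens x y (pt x y u ((1 + d) * h))"
    unfolding q pt_mem_half_lens_iff[OF assms(1)] by (intro conjI hc) (use up d in simp_all)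
  moreover have "pt x y u ((1 - d) * h) \<in> half_lens x y q"
    unfolding q pt_mem_half_lens_iff[OF assms(1)] by (intro conjI hc) (use down d in simp_all)
  moreover have "pt x y u ((1 + d) * h) \<in> U" "pt x y u ((1 - d) * h) \<in> U"
    using d by (auto intro!: e(2) simp: dist_real_def)
  ultimately show "\<exists>z\<in>U. q \<in> half_lens x y z" "\<exists>z\<in>U. z \<in> half_lens x y q" by blast+
qed

lemma interior_mem_half_lens:
  assumes "x \<noteq> y" "z \<in> interior S" "side x y z \<noteq> 0"
  obtains p where "p \<in> S" "z \<in> half_lens x y p"
  using half_lens_nearby(1)[OF assms(1,3) open_interior assms(2)] interior_subset by blast

context expansive_pair
begin

lemma slender_adornments_stay_disjoint:
  assumes S: "slender_adornment S (x 0) (y 0)" and S': "slender_adornment S' (x' 0) (y' 0)"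
    and disj: "\<not> overlap S S'" and t: "t \<in> {0..1}"
  shows "rigid_to (x 0) (y 0) (x t) (y t) ` S
    \<inter> interior (rigid_to (x' 0) (y' 0) (x' t) (y' t) ` S') = {}"
proof (rule ccontr)
  let ?R = "rigid_to (x 0) (y 0) (x t) (y t)"
  let ?R' = "rigid_to (x' 0) (y' 0) (x' t) (y' t)"
  note R = rigid_to_preserves[OF nondeg(1) rigid(1)[OF t]]
  note R' = rigid_to_preserves[OF nondeg(2) rigid(2)[OF t]]
  note SD = slender_adornmentD[OF S] and SD' = slender_adornmentD[OF S']
  interpret sw: expansive_pair x' y' x y by (rule swap)
  assume "?R ` S \<inter> interior (?R' ` S') \<noteq> {}"
  then obtain q where q: "q \<in> ?R ` S" "q \<in> interior (?R' ` S')" by blast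
  obtain z where z: "z \<in> S" "q = ?R z" using q(1) by blast
  have bar: "linepath (x 0) (y 0) u \<in> S" "linepath (x' 0) (y' 0) u \<in> S'" if "u \<in> {0..1}" for u
    using SD(6) SD'(6) linepath_in_path[OF that] by blast+
  have bar_out: "linepath (x 0) (y 0) u \<notin> half_lens (x' 0) (y' 0) p'"
    if "u \<in> {0..1}" "p' \<in> S'" for u p'
    using slender_half_lens_subset_interior[OF S' that(2)] bar(1)[OF that(1)] disj
    unfolding overlap_def by blast
  show False
  proof (cases "side (x t) (y t) q = 0")
    case True
    then have "z \<in> closed_segment (x 0) (y 0)"
      using slender_mem_base[OF S z(1)] z(2) R(3) by simp
    then obtain u where u: "u \<in> {0..1}" "z = linepath (x 0) (y 0) u"
      unfolding linepath_image_01[symmetric] by auto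
    have qu: "q = linepath (x t) (y t) u" using z(2) u(2) rigid_to_linepath[OF nondeg(1)] by simp
    obtain z' where z': "z' \<in> interior S'" "q = ?R' z'"
      using mem_interior_rigid_to_image[OF nondeg(2) nondeg_t(2)[OF t] q(2)] .
    show False
    proof (cases "side (x' t) (y' t) q = 0")
      case True
      then have "z' \<in> closed_segment (x' 0) (y' 0)"
        using slender_mem_base[OF S'] z' interior_subset R'(3) by auto
      then obtain u' where u': "u' \<in> {0..1}" "z' = linepath (x' 0) (y' 0) u'"
        unfolding linepath_image_01[symmetric] by auto
      have "q = linepath (x' t) (y' t) u'"
        using z'(2) u'(2) rigid_to_linepath[OF nondeg(2)] by simp
      then have "u' \<in> {0, 1}" using meet_imp_hinge[OF t u(1) u'(1)] qu by simp
      \<comment> \<open>Contact at a hinge is harmless: the ends of a base are frontier points of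
        the adornment, whereas \<open>z'\<close> is interior.\<close>
      then have "z' = x' 0 \<or> z' = y' 0" using u'(2) by (auto simp: linepath_0' linepath_1')
      then show False using SD'(4,5) z'(1) unfolding frontier_def by auto
    next
      case False
      then have "side (x' 0) (y' 0) z' \<noteq> 0" using z'(2) R'(3) by simp
      then obtain p' where p': "p' \<in> S'" "z' \<in> half_lens (x' 0) (y' 0) p'"
        using interior_mem_half_lens[OF nondeg(2) z'(1)] by blast
      have "linepath (x t) (y t) u \<in>
          half_disc_lens (dist p' (x' 0)) (dist p' (y' 0)) (side (x' 0) (y' 0) p') (x' t) (y' t)"
        using p'(2) z'(2) qu rigid_to_mem_half_disc_lens_iff[OF nondeg(2) rigid(2)[OF t]]
        unfolding half_lens_eq_half_disc_lens by simp
      then have "linepath (x 0) (y 0) u \<in> half_lens (x' 0) (y' 0) p'"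
        unfolding half_lens_eq_half_disc_lens
        using slender_dist_le[OF S' p'(1)] t u(1)
        by (intro sw.bar_point_in_half_disc_lens_earlier[of 0 t u]) auto
      then show False using bar_out[OF u(1) p'(1)] by blast
    qed
  next
    case False
    \<comment> \<open>\<open>q\<close> may be a frontier point of the first carried adornment.
      Moving slightly into its half lens, and then off the line of the second bar, yields a point in
      half lenses of both adornments.\<close>
    define U where "U = interior (?R' ` S') \<inter> half_lens (x t) (y t) q"
    have "open U" unfolding U_def by (intro open_Int open_interior open_half_lens)
    obtain w where w: "w \<in> U"
      unfolding U_def using half_lens_nearby(2)[OF nondeg_t(1)[OF t] False open_interior q(2)] by blast
    obtain w' where w': "w' \<in> U" "side (x' t) (y' t) w' \<noteq> 0"
    proof (cases "side (x' t) (y' t) w = 0")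
      case True
      obtain v where "v \<in> U" "1 * side (x' t) (y' t) v < 0"
        by (rule ex_negative_side_nearby[OF \<open>open U\<close> w one_neq_zero nondeg_t(2)[OF t]]) (simp add: True)
      then show ?thesis using that by auto
    qed (use that w in blast)
    obtain z' where z': "z' \<in> interior S'" "w' = ?R' z'"
      using mem_interior_rigid_to_image[OF nondeg(2) nondeg_t(2)[OF t]] w'(1) unfolding U_def by blast
    have "side (x' 0) (y' 0) z' \<noteq> 0" using w'(2) z'(2) R'(3) by simp
    then obtain p' where p': "p' \<in> S'" "z' \<in> half_lens (x' 0) (y' 0) p'"
      using interior_mem_half_lens[OF nondeg(2) z'(1)] by blast
    interpret hl: expansive_half_lenses x y x' y'
      "dist z (x 0)" "dist z (y 0)" "side (x 0) (y 0) z"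
      "dist p' (x' 0)" "dist p' (y' 0)" "side (x' 0) (y' 0) p'"
    proof
      show "side (x 0) (y 0) z \<noteq> 0" using False z(2) R(3) by simp
      show "side (x' 0) (y' 0) p' \<noteq> 0" using p'(2) unfolding half_lens_def by auto
      show "linepath (x 0) (y 0) u \<notin> half_disc_lens (dist p' (x' 0)) (dist p' (y' 0))
          (side (x' 0) (y' 0) p') (x' 0) (y' 0)" if "u \<in> {0..1}" for u
        using bar_out[OF that p'(1)] unfolding half_lens_eq_half_disc_lens .
      show "linepath (x' 0) (y' 0) u \<notin> half_disc_lens (dist z (x 0)) (dist z (y 0))
          (side (x 0) (y 0) z) (x 0) (y 0)" if "u \<in> {0..1}" for u
        using slender_half_lens_subset_interior[OF S z(1)] bar(2)[OF that] disj
        unfolding overlap_def half_lens_eq_half_disc_lens by blast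
    qed (use slender_dist_le[OF S z(1)] slender_dist_le[OF S' p'(1)] in auto)
    have "w' \<in> half_lens (x t) (y t) q" using w'(1) unfolding U_def by blast
    then have "w' \<in> hl.half_lenses t"
      using p'(2) unfolding hl.half_lenses_def half_lens_eq_half_disc_lens
      by (simp add: z(2) R z'(2) rigid_to_mem_half_disc_lens_iff[OF nondeg(2) rigid(2)[OF t]])
    then have "hl.half_lenses 0 \<noteq> {}" using hl.half_lenses_meet_at_start[OF t] by blast
    then have "half_lens (x 0) (y 0) z \<inter> half_lens (x' 0) (y' 0) p' \<noteq> {}"
      unfolding hl.half_lenses_def half_lens_eq_half_disc_lens .
    then have "S \<inter> interior S' \<noteq> {}"
      using slender_half_lens_subset_interior[OF S z(1)]
        slender_half_lens_subset_interior[OF S' p'(1)] interior_subset[of S] by blast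
    then show False using disj unfolding overlap_def by blast
  qed
qed

end

section \<open>From pairs of bars to the chain\<close>

lemma linepath_eq_endpoint:
  fixes a b :: "'a::real_normed_vector"
  assumes "a \<noteq> b"
  shows "linepath a b u = a \<longleftrightarrow> u = 0" "linepath a b u = b \<longleftrightarrow> u = 1"
proof -
  have diff: "linepath a b u - a = u *\<^sub>R (b - a)" "linepath a b u - b = (u - 1) *\<^sub>R (b - a)"
    by (simp_all add: linepath_def algebra_simps)
  show "linepath a b u = a \<longleftrightarrow> u = 0" "linepath a b u = b \<longleftrightarrow> u = 1"
    unfolding eq_iff_diff_eq_0[of "linepath a b u"] diff using assms by simp_all
qed

lemma chain_bars_less:
  assumes "b \<in> chain_bars n c" "2 \<le> n"
  shows "fst b < n" "snd b < n"
  using assms unfolding chain_bars_def by (auto split: if_splits)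

theorem mainTheorem7:
  fixes n :: nat and closed_chain :: bool
    and C :: "real \<Rightarrow> nat \<Rightarrow> complex"
    and A :: "nat \<times> nat \<Rightarrow> complex set"
  assumes n2: "2 \<le> n" and n3: "closed_chain \<longrightarrow> 3 \<le> n"
    and motion: "continuous_expansive_motion n (chain_bars n closed_chain) C"
    and rel_int_disj: "\<forall>b\<in>chain_bars n closed_chain. \<forall>b'\<in>chain_bars n closed_chain. b \<noteq> b' \<longrightarrow>
          open_segment (C 0 (fst b)) (C 0 (snd b)) \<inter> open_segment (C 0 (fst b')) (C 0 (snd b')) = {}"
    and meet_at_hinges: "\<forall>b\<in>chain_bars n closed_chain. \<forall>b'\<in>chain_bars n closed_chain. b \<noteq> b' \<longrightarrow>
          closed_segment (C 0 (fst b)) (C 0 (snd b)) \<inter> closed_segment (C 0 (fst b')) (C 0 (snd b'))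
            \<subseteq> C 0 ` ({fst b, snd b} \<inter> {fst b', snd b'})"
    and slender: "\<forall>b\<in>chain_bars n closed_chain. slender_adornment (A b) (C 0 (fst b)) (C 0 (snd b))"
    and no_overlap0: "\<forall>b\<in>chain_bars n closed_chain. \<forall>b'\<in>chain_bars n closed_chain. b \<noteq> b' \<longrightarrow>
          \<not> overlap (A b) (A b')"
  shows "\<forall>t\<in>{0..1}. \<forall>b\<in>chain_bars n closed_chain. \<forall>b'\<in>chain_bars n closed_chain. b \<noteq> b' \<longrightarrow>
          \<not> overlap (placed_adornment C A t b) (placed_adornment C A t b')"
proof -
  let ?E = "chain_bars n closed_chain"
  have nondeg: "C 0 (fst b) \<noteq> C 0 (snd b)" if "b \<in> ?E" for b
    using slender that slender_adornmentD(3) by blast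
  \<comment> \<open>Bars are nondegenerate, so the initial position of the vertex \<open>v\<close>
    determines the parameter, and this parameter gives \<open>v\<close> at every time.\<close>
  have bar_end: "linepath (C t (fst b)) (C t (snd b)) u = C t v \<and> u \<in> {0, 1}"
    if bE: "b \<in> ?E" and v: "v \<in> {fst b, snd b}" and eq: "linepath (C 0 (fst b)) (C 0 (snd b)) u = C 0 v" for b v u t
  proof -
    consider "v = fst b" | "v = snd b" using v by blast
    then show ?thesis
    proof cases
      case 1
      then have "u = 0" using eq linepath_eq_endpoint(1)[OF nondeg[OF bE]] by simp
      then show ?thesis using 1 by (simp add: linepath_0')
    next
      case 2
      then have "u = 1" using eq linepath_eq_endpoint(2)[OF nondeg[OF bE]] by simp
      then show ?thesis using 2 by (simp add: linepath_1')
    qed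
  qed
  have pair: "expansive_pair (\<lambda>t. C t (fst b)) (\<lambda>t. C t (snd b)) (\<lambda>t. C t (fst b')) (\<lambda>t. C t (snd b'))"
    if b: "b \<in> ?E" "b' \<in> ?E" and ne: "b \<noteq> b'" for b b'
  proof
    have "\<forall>v<n. continuous_on {0..1} (\<lambda>t. C t v)"
      using motion unfolding continuous_expansive_motion_def by blast
    then show "continuous_on {0..1} (\<lambda>t. C t (fst b))" "continuous_on {0..1} (\<lambda>t. C t (snd b))"
      "continuous_on {0..1} (\<lambda>t. C t (fst b'))" "continuous_on {0..1} (\<lambda>t. C t (snd b'))"
      using chain_bars_less[OF b(1) n2] chain_bars_less[OF b(2) n2] by blast+
    show "C 0 (fst b) \<noteq> C 0 (snd b)" "C 0 (fst b') \<noteq> C 0 (snd b')" using nondeg b by auto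
    have rig: "dist (C t (fst d)) (C t (snd d)) = dist (C 0 (fst d)) (C 0 (snd d))"
      if "t \<in> {0..1}" "d \<in> ?E" for t d
    proof -
      have "\<forall>t\<in>{0..1}. \<forall>(i,j)\<in>?E. dist (C t i) (C t j) = dist (C 0 i) (C 0 j)"
        using motion unfolding continuous_expansive_motion_def by blast
      from bspec[OF bspec[OF this that(1)] that(2)] show ?thesis by (simp only: case_prod_beta)
    qed
    show "dist (C t (fst b)) (C t (snd b)) = dist (C 0 (fst b)) (C 0 (snd b))"
      "dist (C t (fst b')) (C t (snd b')) = dist (C 0 (fst b')) (C 0 (snd b'))"
      if "t \<in> {0..1}" for t by (rule rig[OF that b(1)], rule rig[OF that b(2)])
    show "dist (linepath (C s (fst b)) (C s (snd b)) u) (linepath (C s (fst b')) (C s (snd b')) u')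
        \<le> dist (linepath (C t (fst b)) (C t (snd b)) u) (linepath (C t (fst b')) (C t (snd b')) u')"
      if "0 \<le> s" "s \<le> t" "t \<le> 1" "u \<in> {0..1}" "u' \<in> {0..1}" for s t u u'
    proof -
      have "is_expansion ?E (C s) (C t)"
        using motion that unfolding continuous_expansive_motion_def by blast
      from this[unfolded is_expansion_def, rule_format, OF b that(4,5)]
      show ?thesis unfolding bar_point_def .
    qed
    show "u \<in> {0, 1} \<and> u' \<in> {0, 1} \<and> (\<forall>t\<in>{0..1}.
        linepath (C t (fst b)) (C t (snd b)) u = linepath (C t (fst b')) (C t (snd b')) u')"
      if u: "u \<in> {0..1}" "u' \<in> {0..1}"
        and eq: "linepath (C 0 (fst b)) (C 0 (snd b)) u = linepath (C 0 (fst b')) (C 0 (snd b')) u'"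
      for u u'
    proof -
      have "linepath (C 0 (fst b)) (C 0 (snd b)) u \<in> closed_segment (C 0 (fst b)) (C 0 (snd b))
          \<inter> closed_segment (C 0 (fst b')) (C 0 (snd b'))"
        using linepath_in_path[OF u(1), of "C 0 (fst b)" "C 0 (snd b)"]
          linepath_in_path[OF u(2), of "C 0 (fst b')" "C 0 (snd b')"] eq by simp
      then have "linepath (C 0 (fst b)) (C 0 (snd b)) u \<in> C 0 ` ({fst b, snd b} \<inter> {fst b', snd b'})"
        using meet_at_hinges b ne by blast
      then obtain v where v: "v \<in> {fst b, snd b}" "v \<in> {fst b', snd b'}"
          "linepath (C 0 (fst b)) (C 0 (snd b)) u = C 0 v"
        by blast
      note end1 = bar_end[OF b(1) v(1,3)] and end2 = bar_end[OF b(2) v(2) eq[symmetric, THEN trans, OF v(3)]]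
      show ?thesis
        using end1[THEN conjunct2] end2[THEN conjunct2]
        by (intro conjI ballI trans[OF end1[THEN conjunct1] end2[THEN conjunct1, symmetric]])
    qed
  qed
  show ?thesis
  proof (intro ballI impI)
    fix t :: real and b b' assume t: "t \<in> {0..1}" and b: "b \<in> ?E" "b' \<in> ?E" and ne: "b \<noteq> b'"
    have disj: "\<not> overlap (A b) (A b')" "\<not> overlap (A b') (A b)" using no_overlap0 b ne by auto
    have sl: "slender_adornment (A b) (C 0 (fst b)) (C 0 (snd b))"
      "slender_adornment (A b') (C 0 (fst b')) (C 0 (snd b'))"
      using slender b by auto
    have "placed_adornment C A t b \<inter> interior (placed_adornment C A t b') = {}"
      unfolding placed_adornment_def
      by (rule expansive_pair.slender_adornments_stay_disjoint[OF pair[OF b ne] sl disj(1) t])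
    moreover have "placed_adornment C A t b' \<inter> interior (placed_adornment C A t b) = {}"
      unfolding placed_adornment_def
      by (rule expansive_pair.slender_adornments_stay_disjoint
          [OF pair[OF b(2,1) ne[symmetric]] sl(2,1) disj(2) t])
    ultimately show "\<not> overlap (placed_adornment C A t b) (placed_adornment C A t b')"
      unfolding overlap_def by simp
  qed
qed

end
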